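(* For each $m\in\mathbb{N}$ let $P_m$ be a monic polynomial of degree $m$ having only non-negative real roots. Assume that, as $m\to\infty$, $\frac{m_1(P_m)}{m}\to a$ for some $a\in(0,\infty)$ and $m_2(P_m)=o(m^3)$. Then, for any $d\in\mathbb{N}$, $$\lim_{n\to\infty}\frac{1}{(2n+2d)_{2n}}\,M^n\,\mathfrak{D}_{a^{-1}}P_{n+d}(z)=d!\,(-1)^d\,L_d^{(-1/2)}(z)$$ uniformly on compact subsets of the complex plane, where $M=2(D+2zD^2)$ and $D=\frac{d}{dz}$.
   Context: For a polynomial $P$ of degree $m$ with roots $\lambda_1,\dots,\lambda_m$ (counted with multiplicity), $m_j(P)=\frac1m\sum_{i=1}^m\lambda_i^j$. For $x$ real and $j$ a non-negative integer, $(x)_j=\prod_{i=1}^j(x-i+1)$ is the falling factorial. For $k>0$ the dilation of a polynomial $p$ is $\mathfrak{D}_kp(z)=k^{\deg(p)}p(z/k)$. In the operator $M$, $z$ denotes multiplication by $z$, so $(Mp)(z)=2p'(z)+4zp''(z)$, and $M^n$ is its $n$-fold iterate. The generalized Laguerre polynomial is $L_d^{(-1/2)}(z)=\sum_{k=0}^d\frac{(-1)^k\left(d-\frac12\right)_{d-k}}{k!\,(d-k)!}z^k$. *)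

theory Defs
  imports
    "HOL-Analysis.Analysis"
    "HOL-Computational_Algebra.Computational_Algebra"
    "HOL-Library.Landau_Symbols"
begin

text \<open>The moments \<open>m\<^sub>j(p)\<close>. A complex polynomial splits, so \<open>proots p\<close> lists exactly
  \<open>degree p\<close> roots, with multiplicity. Degree 0 gives the value 0 (division by zero).\<close>
definition root_moment :: "nat \<Rightarrow> complex poly \<Rightarrow> complex" where
  "root_moment j p = (\<Sum>r\<in>#proots p. r ^ j) / of_nat (degree p)"

definition falling_fact :: "real \<Rightarrow> nat \<Rightarrow> real" where
  "falling_fact x j = (\<Prod>i=1..j. x - real i + 1)"

text \<open>Meant for \<open>k > 0\<close> only.\<close>
definition dilation :: "real \<Rightarrow> complex poly \<Rightarrow> complex poly" where
  "dilation k p = smult (of_real k ^ degree p) (pcompose p [:0, 1 / of_real k:])"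

definition M_op :: "complex poly \<Rightarrow> complex poly" where
  "M_op p = smult 2 (pderiv p + smult 2 ([:0, 1:] * pderiv (pderiv p)))"

definition laguerre :: "real \<Rightarrow> nat \<Rightarrow> complex \<Rightarrow> complex" where
  "laguerre \<alpha> d z =
     (\<Sum>k=0..d. of_real ((- 1) ^ k * falling_fact (real d + \<alpha>) (d - k)
        / (fact k * fact (d - k))) * z ^ k)"

end

theory Submission
  imports Defs
begin

text \<open>
  The operator \<open>M\<close> sends \<open>z ^ k\<close> to \<open>2 k (2 k - 1) z ^ (k - 1)\<close>, so \<open>M ^ n\<close> only shifts and
  rescales coefficients: of a polynomial of degree \<open>m = n + d\<close> it keeps the top \<open>d + 1\<close>
  coefficients, multiplied by ratios of factorials (lemma \<open>coeff_M_op_funpow\<close>). Since the degrees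
  stay at most \<open>d\<close>, locally uniform convergence is the same as convergence of each of these
  coefficients (lemma \<open>uniform_limit_poly\<close>).

  Up to sign, the coefficient of \<open>z ^ (m - i)\<close> in \<open>P m\<close> is the elementary symmetric function
  \<open>e\<^sub>i\<close> of the roots. The hypotheses say that the power sums satisfy \<open>p\<^sub>1 \<sim> a m\<^sup>2\<close> and
  \<open>p\<^sub>2 = o(m ^ 4) = o(p\<^sub>1\<^sup>2)\<close>. Hence in the expansion of \<open>p\<^sub>1 ^ i\<close> the terms with a repeated root
  are negligible, while every squarefree monomial occurs \<open>i!\<close> times, so that
  \<open>e\<^sub>i \<sim> p\<^sub>1 ^ i / i! \<sim> (a m\<^sup>2) ^ i / i!\<close> (lemma \<open>tendsto_esym\<close>).

  The dilation removes \<open>a ^ i\<close>, and the normalised factorials behave like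
  \<open>(2 d)! / (2 d - 2 i)! \<cdot> (2 m) ^ (- 2 i)\<close>, which removes \<open>m ^ (2 i)\<close>. The limit of the coefficient of
  \<open>z ^ (d - i)\<close> is therefore \<open>(-1) ^ i (2 d)! / ((2 d - 2 i)! 4 ^ i i!)\<close>, and the duplication
  formula \<open>falling_fact_half\<close> identifies it with the coefficient of the Laguerre polynomial with
  parameter \<open>-1/2\<close>.
\<close>

section \<open>Elementary symmetric functions of non-negative numbers\<close>

text \<open>
  The generating polynomial \<open>\<Prod> (1 + x t)\<close> makes adding one element a multiplication by a linear
  factor, and so reduces statements on all \<open>e\<^sub>k\<close> to an induction on the multiset.
\<close>
definition esym :: "nat \<Rightarrow> 'a::comm_ring_1 multiset \<Rightarrow> 'a" where
  "esym k X = coeff (\<Prod>x\<in>#X. [:1, x:]) k"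

lemma esym_empty: "esym k {#} = (if k = 0 then 1 else 0)"
  by (simp add: esym_def)

lemma esym_0 [simp]: "esym 0 X = 1"
  by (induction X) (simp_all add: esym_def)

lemma esym_add_mset_Suc: "esym (Suc k) (add_mset x X) = esym (Suc k) X + x * esym k X"
  by (simp add: esym_def)

lemma esym_1: "esym (Suc 0) X = sum_mset X"
  by (induction X) (simp_all add: esym_empty esym_add_mset_Suc)

lemma esym_nonneg:
  fixes X :: "'a::linordered_idom multiset"
  assumes "\<And>x. x \<in># X \<Longrightarrow> x \<ge> 0"
  shows "esym k X \<ge> 0"
  using assms
proof (induction X arbitrary: k)
  case empty
  show ?case by (simp add: esym_empty)
next
  case (add x X)
  then show ?case by (cases k) (simp_all add: esym_add_mset_Suc)
qed

text \<open>
  In \<open>p\<^sub>1 e\<^sub>k\<close>, every squarefree monomial of degree \<open>k + 1\<close> arises \<open>k + 1\<close> times, once for each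
  choice of the factor taken from \<open>p\<^sub>1\<close>. The remaining terms \<open>x\<^sup>2 \<cdot> (monomial of degree k - 1)\<close>
  are non-negative, which gives the lower bound; bounding their sum by \<open>p\<^sub>2 e\<^sub>k\<^sub>-\<^sub>1\<close> gives the upper
  bound that follows. Together these two inequalities replace the higher Newton identities, so that
  no power sum beyond the second has to be controlled.
\<close>
lemma esym_newton_lower:
  fixes X :: "'a::linordered_idom multiset"
  assumes "\<And>x. x \<in># X \<Longrightarrow> x \<ge> 0"
  shows "of_nat (Suc k) * esym (Suc k) X \<le> sum_mset X * esym k X"
  using assms
proof (induction X arbitrary: k)
  case empty
  show ?case by (simp add: esym_empty)
next
  case (add x X)
  show ?case
  proof (cases k)
    case 0
    then show ?thesis by (simp add: esym_1)
  next
    case (Suc i)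
    have "x * (of_nat (Suc i) * esym (Suc i) X) \<le> x * (sum_mset X * esym i X)"
      using add by (intro mult_left_mono) auto
    moreover have "of_nat (Suc k) * esym (Suc k) X \<le> sum_mset X * esym k X"
      using add by auto
    moreover have "0 \<le> x * x * esym i X"
      using add by (intro mult_nonneg_nonneg esym_nonneg) auto
    ultimately show ?thesis
      by (simp add: Suc esym_add_mset_Suc algebra_simps)
  qed
qed

lemma esym_newton_upper:
  fixes X :: "'a::linordered_idom multiset"
  assumes "\<And>x. x \<in># X \<Longrightarrow> x \<ge> 0"
  shows "sum_mset X * esym (Suc k) X - of_nat (Suc (Suc k)) * esym (Suc (Suc k)) X
           \<le> (\<Sum>x\<in>#X. x\<^sup>2) * esym k X"
  using assms
proof (induction X arbitrary: k)
  case empty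
  show ?case by (simp add: esym_empty)
next
  case (add x X)
  define q where "q = (\<Sum>x\<in>#X. x\<^sup>2)"
  have IH: "sum_mset X * esym (Suc k) X - of_nat (Suc (Suc k)) * esym (Suc (Suc k)) X
              \<le> q * esym k X" for k
    using add unfolding q_def by auto
  show ?case
  proof (cases k)
    case 0
    show ?thesis
      using IH[of 0] unfolding 0
      by (simp add: q_def esym_add_mset_Suc esym_1 algebra_simps power2_eq_square)
  next
    case (Suc i)
    have "x * (sum_mset X * esym (Suc i) X - of_nat (Suc (Suc i)) * esym (Suc (Suc i)) X)
            \<le> x * (q * esym i X)"
      using add.prems by (intro mult_left_mono IH) auto
    moreover have "0 \<le> x * x * (x * esym i X)"
      using add.prems by (intro mult_nonneg_nonneg esym_nonneg) auto
    ultimately show ?thesis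
      using IH[of k]
      by (simp add: q_def Suc esym_add_mset_Suc algebra_simps power2_eq_square)
  qed
qed

text \<open>
  After division by \<open>s ^ k\<close> the preceding two inequalities say that
  \<open>k e\<^sub>k / s ^ k\<close> differs from \<open>(p\<^sub>1 / s) (e\<^sub>k\<^sub>-\<^sub>1 / s ^ (k - 1))\<close> by at most
  \<open>(p\<^sub>2 / s\<^sup>2) (e\<^sub>k\<^sub>-\<^sub>2 / s ^ (k - 2))\<close>, which tends to zero. In the limit, the recursion is that of
  \<open>a ^ k / k!\<close>.
\<close>
lemma tendsto_esym:
  fixes X :: "'b \<Rightarrow> real multiset" and s :: "'b \<Rightarrow> real"
  assumes nonneg: "\<And>m x. x \<in># X m \<Longrightarrow> x \<ge> 0"
    and s: "\<And>m. s m \<ge> 0"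
    and sum: "((\<lambda>m. sum_mset (X m) / s m) \<longlongrightarrow> a) F"
    and sumsq: "((\<lambda>m. (\<Sum>x\<in>#X m. x\<^sup>2) / s m ^ 2) \<longlongrightarrow> 0) F"
  shows "((\<lambda>m. esym k (X m) / s m ^ k) \<longlongrightarrow> a ^ k / fact k) F"
proof (induction k rule: less_induct)
  case (less k)
  consider "k = 0" | "k = 1" | i where "k = Suc (Suc i)"
    by (metis One_nat_def not0_implies_Suc)
  then show ?case
  proof cases
    case 1
    then show ?thesis by simp
  next
    case 2
    then show ?thesis using sum by (simp add: esym_1)
  next
    case (3 i)
    \<comment> \<open>The contribution to \<open>p\<^sub>1 e\<^sub>k\<^sub>-\<^sub>1\<close> of the monomials with a repeated factor.\<close>
    define D where "D m = (sum_mset (X m) * esym (Suc i) (X m)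
      - of_nat (Suc (Suc i)) * esym (Suc (Suc i)) (X m)) / s m ^ k" for m
    have "0 \<le> D m" for m
      unfolding D_def using esym_newton_lower[of "X m" "Suc i"] nonneg s
      by (intro divide_nonneg_nonneg) auto
    then have D0: "(D \<longlongrightarrow> 0) F"
    proof (rule tendsto_sandwich[OF always_eventually, OF allI])
      have "D m \<le> (\<Sum>x\<in>#X m. x\<^sup>2) * esym i (X m) / s m ^ k" for m
        unfolding D_def using esym_newton_upper[of "X m" i] nonneg s
        by (intro divide_right_mono) auto
      then show "\<forall>\<^sub>F m in F. D m \<le> (\<Sum>x\<in>#X m. x\<^sup>2) / s m ^ 2 * (esym i (X m) / s m ^ i)"
        by (simp add: 3 power2_eq_square mult.assoc)
      show "((\<lambda>m. (\<Sum>x\<in>#X m. x\<^sup>2) / s m ^ 2 * (esym i (X m) / s m ^ i)) \<longlongrightarrow> 0) F"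
        using tendsto_mult[OF sumsq less[of i]] 3 by simp
    qed simp
    have "((\<lambda>m. (sum_mset (X m) / s m * (esym (Suc i) (X m) / s m ^ Suc i) - D m) / real k)
        \<longlongrightarrow> (a * (a ^ Suc i / fact (Suc i)) - 0) / real k) F"
      using 3 by (intro tendsto_intros sum less D0) auto
    moreover have "(sum_mset (X m) / s m * (esym (Suc i) (X m) / s m ^ Suc i) - D m) / real k
        = esym k (X m) / s m ^ k" for m
    proof -
      have "sum_mset (X m) / s m * (esym (Suc i) (X m) / s m ^ Suc i) - D m
          = real k * esym k (X m) / s m ^ k"
        by (simp add: D_def 3 diff_divide_distrib)
      then show ?thesis using 3 by simp
    qed
    moreover have "(a * (a ^ Suc i / fact (Suc i)) - 0) / real k = a ^ k / fact k"
      by (simp add: 3 field_simps)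
    ultimately show ?thesis by simp
  qed
qed

text \<open>
  Vieta's formulas. Reversing the coefficients turns each factor \<open>z - r\<close> into \<open>1 - r z\<close>, so the
  coefficient counted from the top becomes the \<open>k\<close>-th one of the generating polynomial, whatever the
  degree.
\<close>
lemma coeff_eq_esym_roots:
  fixes p :: "complex poly"
  assumes monic: "lead_coeff p = 1" and real: "\<And>z. poly p z = 0 \<Longrightarrow> z \<in> \<real>"
    and k: "k \<le> degree p"
  shows "coeff p (degree p - k) = (- 1) ^ k * of_real (esym k (image_mset Re (proots p)))"
proof -
  have reals: "z \<in> \<real>" if "z \<in># proots p" for z
    using that monic real by (cases "p = 0") auto
  have "coeff (reflect_poly (\<Prod>r\<in>#X. [:-r, 1:])) k = (- 1) ^ k * of_real (esym k (image_mset Re X))"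
    if "\<And>z. z \<in># X \<Longrightarrow> z \<in> \<real>" for X :: "complex multiset"
    using that
  proof (induction X arbitrary: k)
    case empty
    show ?case by (simp add: esym_empty)
  next
    case (add x X)
    have x: "of_real (Re x) = x" using add.prems by (simp add: complex_is_Real_iff complex_eq_iff)
    have r: "reflect_poly [:-x, 1:] = [:1, -x:]"
      by (rule poly_eqI) (auto simp: coeff_reflect_poly coeff_pCons split: nat.splits)
    have "reflect_poly (\<Prod>r\<in>#add_mset x X. [:-r, 1:]) = [:1, -x:] * reflect_poly (\<Prod>r\<in>#X. [:-r, 1:])"
      by (simp only: image_mset_add_mset prod_mset.add_mset reflect_poly_mult r)
    also have "coeff \<dots> k = (- 1) ^ k * of_real (esym k (image_mset Re (add_mset x X)))"
    proof (cases k)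
      case 0
      then show ?thesis using add.IH[of 0] add.prems by simp
    next
      case (Suc i)
      then show ?thesis
        using add.IH[of i] add.IH[of "Suc i"] add.prems
        by (simp add: esym_add_mset_Suc x algebra_simps)
    qed
    finally show ?case .
  qed
  from this[of "proots p", OF reals] have "coeff (reflect_poly p) k = (- 1) ^ k * of_real (esym k (image_mset Re (proots p)))"
    using complex_poly_decompose_multiset[of p] monic by simp
  then show ?thesis using k by (simp add: coeff_reflect_poly)
qed

lemma root_moment_eq_sum:
  assumes "p \<noteq> 0" and real: "\<And>z. poly p z = 0 \<Longrightarrow> z \<in> \<real>"
  shows "root_moment j p = of_real ((\<Sum>x\<in>#image_mset Re (proots p). x ^ j) / degree p)"
proof -
  have "(\<Sum>r\<in>#X. r ^ j) = of_real (\<Sum>x\<in>#image_mset Re X. x ^ j)"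
    if "\<And>z. z \<in># X \<Longrightarrow> z \<in> \<real>" for X :: "complex multiset"
    using that
  proof (induction X)
    case (add x X)
    have x: "of_real (Re x) = x" using add.prems by (simp add: complex_is_Real_iff complex_eq_iff)
    then show ?case using add by simp
  qed simp
  from this[of "proots p"] show ?thesis
    using assms by (simp add: root_moment_def)
qed

section \<open>Falling factorials\<close>

lemma falling_fact_0 [simp]: "falling_fact x 0 = 1"
  by (simp add: falling_fact_def)

lemma falling_fact_Suc: "falling_fact x (Suc j) = falling_fact x j * (x - real j)"
  by (simp add: falling_fact_def)

lemma falling_fact_Suc_left: "falling_fact x (Suc j) = x * falling_fact (x - 1) j"
  by (induction j) (simp_all add: falling_fact_Suc algebra_simps)

lemma falling_fact_fact: "falling_fact (real (N + j)) j = fact (N + j) / fact N"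
  by (induction j) (simp_all add: falling_fact_Suc_left add_ac)

text \<open>
  The duplication formula \<open>(2 d)\<^bsub>2 i\<^esub> = 4 ^ i (d)\<^bsub>i\<^esub> (d - 1/2)\<^bsub>i\<^esub>\<close> for \<open>d = k + i\<close>, which separates the
  even and the odd factors of \<open>(2 d)! / (2 k)!\<close>. This is where the Laguerre parameter \<open>-1/2\<close> comes
  from.
\<close>
lemma falling_fact_half:
  "falling_fact (real (k + i) - 1 / 2) i
     = fact (2 * (k + i)) * fact k / (4 ^ i * fact (k + i) * fact (2 * k))"
proof (induction i)
  case (Suc i)
  have "falling_fact (real (k + Suc i) - 1 / 2) (Suc i)
      = (real (k + i) + 1 / 2) * falling_fact (real (k + i) - 1 / 2) i"
    by (simp add: falling_fact_Suc_left algebra_simps)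
  moreover have "fact (2 * (k + Suc i)) * fact k / (4 ^ Suc i * fact (k + Suc i) * fact (2 * k))
      = (real (k + i) + 1 / 2) * (fact (2 * (k + i)) * fact k / (4 ^ i * fact (k + i) * fact (2 * k)))"
    by (simp add: divide_simps) (simp add: algebra_simps)
  ultimately show ?case by (simp only: Suc.IH)
qed simp

lemma tendsto_falling_fact:
  fixes c :: real
  shows "(\<lambda>m. falling_fact (c * real m) j / real m ^ j) \<longlonglongrightarrow> c ^ j"
proof (induction j)
  case (Suc j)
  have "(\<lambda>m. c - real j * (1 / real m)) \<longlonglongrightarrow> c - real j * 0"
    by (intro tendsto_intros lim_1_over_n)
  moreover have "\<forall>\<^sub>F m in sequentially. c - real j * (1 / real m) = (c * real m - real j) / real m"
    using eventually_gt_at_top[of 0] by eventually_elim (simp add: field_simps)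
  ultimately have "(\<lambda>m. (c * real m - real j) / real m) \<longlonglongrightarrow> c"
    using Lim_transform_eventually by fastforce
  from tendsto_mult[OF Suc this] show ?case
    by (simp add: falling_fact_Suc mult_ac)
qed simp

section \<open>The action on coefficients and convergence\<close>

lemma coeff_M_op: "coeff (M_op p) k = of_nat (2 * k + 2) * of_nat (2 * k + 1) * coeff p (Suc k)"
  by (cases k) (simp_all add: M_op_def coeff_pderiv algebra_simps)

lemma coeff_M_op_funpow:
  "coeff ((M_op ^^ n) p) k = fact (2 * (n + k)) / fact (2 * k) * coeff p (n + k)"
proof (induction n arbitrary: k)
  case (Suc n)
  have "coeff ((M_op ^^ Suc n) p) k
      = of_nat (2 * k + 2) * of_nat (2 * k + 1) * (fact (2 * (n + Suc k)) / fact (2 * Suc k)) * coeff p (n + Suc k)"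
    by (simp add: coeff_M_op Suc.IH del: of_nat_Suc of_nat_add)
  also have "of_nat (2 * k + 2) * of_nat (2 * k + 1) * (fact (2 * (n + Suc k)) / fact (2 * Suc k) :: complex)
      = fact (2 * (n + Suc k)) / fact (2 * k)"
  proof -
    have "(fact (2 * Suc k) :: complex) = of_nat (2 * k + 2) * of_nat (2 * k + 1) * fact (2 * k)"
      by (simp add: algebra_simps)
    moreover have "(of_nat (2 * k + 2) * of_nat (2 * k + 1) :: complex) \<noteq> 0"
      by (simp only: of_nat_mult[symmetric] of_nat_eq_0_iff) simp
    ultimately show ?thesis by simp
  qed
  finally show ?case by simp
qed simp

text \<open>
  Polynomials of degree at most \<open>d\<close> form a finite-dimensional space, so coefficientwise convergence
  controls them uniformly on every bounded set.
\<close>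
lemma uniform_limit_poly:
  fixes p :: "nat \<Rightarrow> complex poly"
  assumes deg: "\<And>n. degree (p n) \<le> d"
    and lim: "\<And>k. k \<le> d \<Longrightarrow> (\<lambda>n. coeff (p n) k) \<longlonglongrightarrow> c k"
    and K: "bounded K"
  shows "uniform_limit K (\<lambda>n. poly (p n)) (\<lambda>z. \<Sum>k\<le>d. c k * z ^ k) sequentially"
proof -
  obtain B where B: "\<And>z. z \<in> K \<Longrightarrow> norm z \<le> B"
    using K by (auto simp: bounded_iff)
  have bdd: "bounded ((\<lambda>z. z ^ k) ` K)" for k
    unfolding bounded_iff using B
    by (auto simp: norm_power intro!: exI[of _ "B ^ k"] power_mono)
  have bdd_const: "bounded ((\<lambda>_. w) ` K)" for w :: complex
    by (rule bounded_subset[of "{w}"]) auto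
  have const: "uniform_limit K (\<lambda>n z. coeff (p n) k) (\<lambda>z. c k) sequentially" if "k \<le> d" for k
    using lim[OF that] by (auto simp: uniform_limit_iff tendsto_iff elim: eventually_mono)
  have partial: "uniform_limit K (\<lambda>n z. \<Sum>k\<le>e. coeff (p n) k * z ^ k) (\<lambda>z. \<Sum>k\<le>e. c k * z ^ k) sequentially"
    if "e \<le> d" for e
    using that
  proof (induction e)
    case 0
    then show ?case using const[of 0] by simp
  next
    case (Suc e)
    have "uniform_limit K (\<lambda>n z. coeff (p n) (Suc e) * z ^ Suc e) (\<lambda>z. c (Suc e) * z ^ Suc e) sequentially"
      using Suc.prems by (intro uniform_lim_mult const uniform_limit_const bdd bdd_const) auto
    then show ?case using Suc by (auto intro: uniform_limit_add)
  qed
  have "(\<Sum>k\<le>d. coeff (p n) k * z ^ k) = poly (p n) z" for n z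
    using arg_cong[OF poly_as_sum_of_monoms'[OF deg[of n]], of "\<lambda>q. poly q z"]
    by (simp add: poly_sum poly_monom)
  then show ?thesis using partial[of d] by simp
qed

theorem theorem2p13:
  fixes P :: "nat \<Rightarrow> complex poly" and a :: real and d :: nat
  assumes monic: "\<And>m. lead_coeff (P m) = 1"
    and deg: "\<And>m. degree (P m) = m"
    and roots: "\<And>m z. poly (P m) z = 0 \<Longrightarrow> z \<in> \<real> \<and> Re z \<ge> 0"
    and a_pos: "a > 0"
    and moment1: "(\<lambda>m. root_moment 1 (P m) / of_nat m) \<longlonglongrightarrow> of_real a"
    and moment2: "(\<lambda>m. root_moment 2 (P m)) \<in> o(\<lambda>m. of_nat m ^ 3)"
  shows "\<forall>K. compact K \<longrightarrow>
    uniform_limit K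
      (\<lambda>n z. 1 / of_real (falling_fact (2 * real n + 2 * real d) (2 * n))
             * poly ((M_op ^^ n) (dilation (inverse a) (P (n + d)))) z)
      (\<lambda>z. fact d * (- 1) ^ d * laguerre (- 1 / 2) d z)
      sequentially"
proof (intro allI impI)
  fix K :: "complex set"
  assume K: "compact K"
  define X where "X m = image_mset Re (proots (P m))" for m
  have nz: "P m \<noteq> 0" for m
    using monic[of m] by auto
  have real_roots: "z \<in> \<real>" if "poly (P m) z = 0" for m z
    using roots that by blast
  have X_nonneg: "x \<ge> 0" if "x \<in># X m" for x m
    using that roots nz by (auto simp: X_def)
  have moment: "root_moment j (P m) = of_real ((\<Sum>x\<in>#X m. x ^ j) / m)" for j m
    using root_moment_eq_sum[OF nz real_roots] by (simp add: X_def deg)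
  have "(\<lambda>m. complex_of_real (sum_mset (X m) / real m ^ 2)) \<longlonglongrightarrow> of_real a"
    using moment1 by (simp add: moment power2_eq_square)
  then have sum: "(\<lambda>m. sum_mset (X m) / real m ^ 2) \<longlonglongrightarrow> a"
    by (simp only: tendsto_of_real_iff)
  have "(\<lambda>m. complex_of_real ((\<Sum>x\<in>#X m. x\<^sup>2) / (real m ^ 2) ^ 2)) \<longlonglongrightarrow> of_real 0"
    using smalloD_tendsto[OF moment2] by (simp add: moment eval_nat_numeral mult.assoc)
  then have sumsq: "(\<lambda>m. (\<Sum>x\<in>#X m. x\<^sup>2) / (real m ^ 2) ^ 2) \<longlonglongrightarrow> 0"
    by (simp only: tendsto_of_real_iff)
  have esym_lim: "(\<lambda>m. esym i (X m) / (real m ^ 2) ^ i) \<longlonglongrightarrow> a ^ i / fact i" for i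
    by (rule tendsto_esym[OF X_nonneg _ sum sumsq]) auto

  \<comment> \<open>\<open>C\<close> is the normalising constant, \<open>Q\<close> the normalised polynomial, and \<open>c k\<close> the limit of its
    \<open>k\<close>-th coefficient.\<close>
  define C where "C n = falling_fact (2 * real n + 2 * real d) (2 * n)" for n
  define Q where "Q n = smult (1 / of_real (C n)) ((M_op ^^ n) (dilation (inverse a) (P (n + d))))" for n
  define c :: "nat \<Rightarrow> real" where
    "c k = (- 1) ^ (d - k) * fact (2 * d) / (fact (2 * k) * 4 ^ (d - k) * fact (d - k))" for k
  have C: "C n = fact (2 * (n + d)) / fact (2 * d)" for n
    using falling_fact_fact[of "2 * d" "2 * n"] by (simp add: C_def algebra_simps)
  have coeff_dilation: "coeff (dilation (inverse a) (P m)) j = of_real (inverse a ^ m * a ^ j) * coeff (P m) j" for m j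
    by (simp add: dilation_def deg coeff_pcompose_linear inverse_eq_divide)
  have coeff_Q: "coeff (Q n) k = of_real (fact (2 * (n + k)) * fact (2 * d) / (fact (2 * k) * fact (2 * (n + d)))
      * (inverse a ^ (n + d) * a ^ (n + k))) * coeff (P (n + d)) (n + k)" for n k
    by (simp add: Q_def coeff_M_op_funpow coeff_dilation C mult_ac)
  have deg_Q: "degree (Q n) \<le> d" for n
    by (rule degree_le) (simp add: coeff_Q coeff_eq_0 deg)
  have lim_Q: "(\<lambda>n. coeff (Q n) k) \<longlonglongrightarrow> of_real (c k)" if k: "k \<le> d" for k
  proof -
    define i where "i = d - k"
    have d: "d = k + i" using k by (simp add: i_def)
    \<comment> \<open>The \<open>k\<close>-th coefficient of \<open>Q n\<close>, for \<open>m = n + d\<close>, with \<open>m ^ (2 * i)\<close> split off from both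
      \<open>m\<close>-dependent factors. Cancelling this power requires \<open>m > 0\<close>.\<close>
    define G where "G m = (- 1) ^ i * inverse a ^ i * (fact (2 * d) / fact (2 * k))
      * (esym i (X m) / (real m ^ 2) ^ i) * inverse (falling_fact (2 * real m) (2 * i) / real m ^ (2 * i))" for m
    have "G \<longlonglongrightarrow> (- 1) ^ i * inverse a ^ i * (fact (2 * d) / fact (2 * k))
      * (a ^ i / fact i) * inverse (2 ^ (2 * i))"
      unfolding G_def by (intro tendsto_intros esym_lim tendsto_falling_fact) auto
    also have "(- 1) ^ i * inverse a ^ i * (fact (2 * d) / fact (2 * k)) * (a ^ i / fact i) * inverse (2 ^ (2 * i)) = c k"
      using a_pos power_mult[of "2 :: real" 2 i]
      by (simp add: c_def i_def[symmetric] divide_simps)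
    finally have "G \<longlonglongrightarrow> c k" .
    then have "(\<lambda>n. G (n + d)) \<longlonglongrightarrow> c k"
      by (rule LIMSEQ_ignore_initial_segment)
    then have "(\<lambda>n. complex_of_real (G (n + d))) \<longlonglongrightarrow> of_real (c k)"
      by (rule tendsto_of_real)
    moreover have "\<forall>\<^sub>F n in sequentially. of_real (G (n + d)) = coeff (Q n) k"
      using eventually_gt_at_top[of 0]
    proof eventually_elim
      case (elim n)
      have "coeff (P (n + d)) (n + k) = (- 1) ^ i * of_real (esym i (X (n + d)))"
        using coeff_eq_esym_roots[of "P (n + d)" i, OF monic real_roots]
        by (simp add: deg d X_def)
      moreover have "inverse a ^ (n + d) * a ^ (n + k) = inverse a ^ i"
        using a_pos by (simp add: d power_add field_simps)
      ultimately have "coeff (Q n) k = of_real (fact (2 * (n + k)) * fact (2 * d) / (fact (2 * k) * fact (2 * (n + d)))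
          * inverse a ^ i * ((- 1) ^ i * esym i (X (n + d))))"
        by (simp add: coeff_Q del: power_inverse)
      moreover have "falling_fact (2 * real (n + d)) (2 * i) = fact (2 * (n + d)) / fact (2 * (n + k))"
        using falling_fact_fact[of "2 * (n + k)" "2 * i"] by (simp add: d algebra_simps)
      then have "G (n + d) = fact (2 * (n + k)) * fact (2 * d) / (fact (2 * k) * fact (2 * (n + d)))
          * inverse a ^ i * ((- 1) ^ i * esym i (X (n + d)))"
        using elim unfolding G_def by (simp add: power_mult del: of_nat_add power_inverse)
      ultimately show ?case by simp
    qed
    ultimately show ?thesis
      by (rule Lim_transform_eventually)
  qed
  have "uniform_limit K (\<lambda>n z. poly (Q n) z) (\<lambda>z. \<Sum>k\<le>d. of_real (c k) * z ^ k) sequentially"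
    by (rule uniform_limit_poly[OF deg_Q lim_Q compact_imp_bounded[OF K]])
  moreover have "(\<Sum>k\<le>d. of_real (c k) * z ^ k) = fact d * (- 1) ^ d * laguerre (- 1 / 2) d z" for z
    unfolding laguerre_def sum_distrib_left atLeast0AtMost
  proof (rule sum.cong)
    fix k assume "k \<in> {..d}"
    then obtain i where d: "d = k + i" by (metis atMost_iff le_Suc_ex)
    have half: "falling_fact (real d + - 1 / 2) (d - k)
        = fact (2 * d) * fact k / (4 ^ i * fact d * fact (2 * k))"
      using falling_fact_half[of k i] by (simp add: d)
    have "c k = fact d * (- 1) ^ d * ((- 1) ^ k * falling_fact (real d + - 1 / 2) (d - k) / (fact k * fact (d - k)))"
      unfolding half by (simp add: c_def d power_add divide_simps)
    from arg_cong[OF this, of complex_of_real] have "complex_of_real (c k) = fact d * (- 1) ^ d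
        * of_real ((- 1) ^ k * falling_fact (real d + - 1 / 2) (d - k) / (fact k * fact (d - k)))"
      by (simp only: of_real_mult of_real_fact of_real_power of_real_minus of_real_1)
    then show "of_real (c k) * z ^ k = fact d * (- 1) ^ d
        * (of_real ((- 1) ^ k * falling_fact (real d + - 1 / 2) (d - k) / (fact k * fact (d - k))) * z ^ k)"
      by (simp only: mult.assoc)
  qed simp
  ultimately show "uniform_limit K
      (\<lambda>n z. 1 / of_real (falling_fact (2 * real n + 2 * real d) (2 * n))
             * poly ((M_op ^^ n) (dilation (inverse a) (P (n + d)))) z)
      (\<lambda>z. fact d * (- 1) ^ d * laguerre (- 1 / 2) d z) sequentially"
    by (simp only: Q_def C_def poly_smult)
qed

end
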